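(* Let $f: X \to Y$ be a perfectly normal mapping and let $X_0\subset X$ be any subset. Then the submapping $f|_{X_{0}}: X_{0} \to Y$ is perfectly normal.
   Context: All spaces are topological spaces; mappings $f:X\to Y$ are continuous; neighborhoods are open; functions are real-valued and not necessarily continuous. A submapping of $f:X\to Y$ is a restriction $f|_{X_0}:X_0\to Y$ to a subset $X_0\subset X$ with the subspace topology. For a bounded $\varphi:X\to\mathbb R$ and $x\in X$, $\mathrm{osc}_\varphi(x)=\inf\{\sup_{z\in U}|\varphi(x)-\varphi(z)| : U \text{ an open neighborhood of } x\}$; for non-empty $A\subset X$, $\mathrm{osc}_\varphi(A)=\sup_{x\in A}\mathrm{osc}_\varphi(x)$, and $\mathrm{osc}_\varphi(\varnothing)=0$. A family of functions $\{\varphi_n:X\to[0,1]\}_{n\in\mathbb N}$ is $f$-equicontinuous at $y\in Y$ if for any $\varepsilon>0$ there is a neighborhood $\mathcal{O}y$ of $y$ with $\mathrm{osc}_{\varphi_n}(f^{-1}\mathcal{O}y)<\varepsilon$ for every $n\in\mathbb N$. A mapping $f:X\to Y$ is perfectly normal if for any open subset $O\subset X$ and any point $y\in Y$ there exist a neighborhood $\mathcal{O}y$ of $y$ and a countable family of functions $\{\varphi_l:X\to[0,1]\mid l\in\mathbb N\}$, $f$-equicontinuous at $y$, such that (1) $O\cap f^{-1}\mathcal{O}y=\bigcup_{l\in\mathbb N}(\varphi_l^{-1}(1)\cap f^{-1}\mathcal{O}y)$; (2) $f^{-1}\mathcal{O}y\setminus O\subset\varphi_l^{-1}(0)\cap f^{-1}\mathcal{O}y$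 for all $l\in\mathbb N$. *)

theory Defs
  imports "HOL-Analysis.Analysis"
begin

text \<open>Spaces are abstract topologies, so a function on a space is a total function of which only
  the values on \<open>topspace X\<close> matter.\<close>

definition top_preimage :: "'a topology \<Rightarrow> ('a \<Rightarrow> 'b) \<Rightarrow> 'b set \<Rightarrow> 'a set" where
  "top_preimage X f B = {x \<in> topspace X. f x \<in> B}"

text \<open>For \<open>x \<in> topspace X\<close> and \<open>\<phi>\<close> bounded on \<open>topspace X\<close>, the infima and suprema below are
  taken over nonempty sets of reals bounded on the relevant side. No continuity of \<open>\<phi>\<close> is
  assumed.\<close>

definition osc_at :: "'a topology \<Rightarrow> ('a \<Rightarrow> real) \<Rightarrow> 'a \<Rightarrow> real" where
  "osc_at X \<phi> x = (INF U \<in> {U. openin X U \<and> x \<in> U}. SUP z\<in>U. \<bar>\<phi> x - \<phi> z\<bar>)"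

definition osc_on :: "'a topology \<Rightarrow> ('a \<Rightarrow> real) \<Rightarrow> 'a set \<Rightarrow> real" where
  "osc_on X \<phi> A = (if A = {} then 0 else SUP x\<in>A. osc_at X \<phi> x)"

definition equicontinuous_map_at ::
    "'a topology \<Rightarrow> 'b topology \<Rightarrow> ('a \<Rightarrow> 'b) \<Rightarrow> (nat \<Rightarrow> 'a \<Rightarrow> real) \<Rightarrow> 'b \<Rightarrow> bool" where
  "equicontinuous_map_at X Y f \<phi> y \<longleftrightarrow>
     (\<forall>n. \<phi> n \<in> topspace X \<rightarrow> {0..1}) \<and>
     (\<forall>\<epsilon>>0. \<exists>V. openin Y V \<and> y \<in> V \<and> (\<forall>n. osc_on X (\<phi> n) (top_preimage X f V) < \<epsilon>))"

definition perfectly_normal_map :: "'a topology \<Rightarrow> 'b topology \<Rightarrow> ('a \<Rightarrow> 'b) \<Rightarrow> bool" where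
  "perfectly_normal_map X Y f \<longleftrightarrow>
     continuous_map X Y f \<and>
     (\<forall>W y. openin X W \<longrightarrow> y \<in> topspace Y \<longrightarrow>
        (\<exists>V \<phi>. openin Y V \<and> y \<in> V \<and>
           equicontinuous_map_at X Y f \<phi> y \<and>
           W \<inter> top_preimage X f V =
             (\<Union>l. top_preimage X (\<phi> l) {1} \<inter> top_preimage X f V) \<and>
           (\<forall>l. top_preimage X f V - W \<subseteq> top_preimage X (\<phi> l) {0} \<inter> top_preimage X f V)))"

end

theory Submission
  imports Defs
begin

text \<open>
  An open set of the subspace is the trace \<open>W \<inter> X0\<close> of an open set \<open>W\<close> of \<open>X\<close>, and the
  neighbourhood and the functions that witness perfect normality for \<open>W\<close> serve for \<open>W \<inter> X0\<close> as
  well: preimages under the submapping, and level sets of functions restricted to \<open>X0\<close>, are traces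
  on \<open>X0\<close>, so the two set conditions are simply intersected with \<open>X0\<close>.

  The one point with content is equicontinuity. Each neighbourhood \<open>U\<close> of \<open>x \<in> X0\<close> in \<open>X\<close> gives the
  neighbourhood \<open>U \<inter> X0\<close> in the subspace, over which the deviation from \<open>\<phi> x\<close> has a smaller
  supremum; hence the oscillation at a point can only decrease on passing to a subspace
  (\<open>osc_at_subtopology_le\<close>). Taking the supremum over a smaller set decreases it further
  (\<open>osc_on_subtopology_le\<close>), so the same neighbourhoods of \<open>y\<close> work for the submapping. Boundedness
  of the functions is what makes all these real infima and suprema monotone.
\<close>

lemma bounded_deviation:
  fixes \<phi> :: "'a \<Rightarrow> real"
  assumes "bounded (\<phi> ` S)"
  obtains B where "\<And>x z. x \<in> S \<Longrightarrow> z \<in> S \<Longrightarrow> \<bar>\<phi> x - \<phi> z\<bar> \<le> B"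
proof -
  obtain b where "\<And>x. x \<in> S \<Longrightarrow> \<bar>\<phi> x\<bar> \<le> b"
    using assms unfolding bounded_iff by auto
  then have "\<bar>\<phi> x - \<phi> z\<bar> \<le> b + b" if "x \<in> S" "z \<in> S" for x z
    using that abs_triangle_ineq4[of "\<phi> x" "\<phi> z"] by (meson add_mono order_trans)
  then show thesis by (rule that)
qed

lemma bdd_above_deviation:
  fixes \<phi> :: "'a \<Rightarrow> real"
  assumes "bounded (\<phi> ` topspace X)" "x \<in> topspace X" "openin X U"
  shows "bdd_above ((\<lambda>z. \<bar>\<phi> x - \<phi> z\<bar>) ` U)"
proof -
  obtain B where "\<And>x z. x \<in> topspace X \<Longrightarrow> z \<in> topspace X \<Longrightarrow> \<bar>\<phi> x - \<phi> z\<bar> \<le> B"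
    using bounded_deviation[OF assms(1)] by blast
  then show ?thesis
    using assms(2) openin_subset[OF assms(3)] by (intro bdd_aboveI[of _ B]) auto
qed

lemma bdd_below_SUP_deviation:
  fixes \<phi> :: "'a \<Rightarrow> real"
  assumes "bounded (\<phi> ` topspace X)"
  shows "bdd_below ((\<lambda>U. SUP z\<in>U. \<bar>\<phi> x - \<phi> z\<bar>) ` {U. openin X U \<and> x \<in> U})"
proof (rule bdd_belowI[of _ 0])
  fix s assume "s \<in> (\<lambda>U. SUP z\<in>U. \<bar>\<phi> x - \<phi> z\<bar>) ` {U. openin X U \<and> x \<in> U}"
  then obtain U where U: "openin X U" "x \<in> U" and s: "s = (SUP z\<in>U. \<bar>\<phi> x - \<phi> z\<bar>)"
    by auto
  then have "x \<in> topspace X"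
    using openin_subset by blast
  then have "\<bar>\<phi> x - \<phi> x\<bar> \<le> s"
    unfolding s using assms U by (intro cSUP_upper bdd_above_deviation)
  then show "0 \<le> s" by simp
qed

lemma bdd_above_osc_at:
  assumes "bounded (\<phi> ` topspace X)" "A \<subseteq> topspace X"
  shows "bdd_above (osc_at X \<phi> ` A)"
proof -
  obtain B where B: "\<And>x z. x \<in> topspace X \<Longrightarrow> z \<in> topspace X \<Longrightarrow> \<bar>\<phi> x - \<phi> z\<bar> \<le> B"
    using bounded_deviation[OF assms(1)] by blast
  have "osc_at X \<phi> x \<le> B" if "x \<in> A" for x
  proof -
    have x: "x \<in> topspace X"
      using that assms(2) by blast
    \<comment> \<open>The whole space is among the neighbourhoods over which the infimum is taken.\<close>
    have "osc_at X \<phi> x \<le> (SUP z\<in>topspace X. \<bar>\<phi> x - \<phi> z\<bar>)"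
      unfolding osc_at_def
      using x by (intro cINF_lower bdd_below_SUP_deviation assms(1)) simp
    also have "\<dots> \<le> B"
      using x B by (intro cSUP_least) auto
    finally show ?thesis .
  qed
  then show ?thesis
    by (intro bdd_aboveI2)
qed

text \<open>The trace of a neighbourhood of \<open>x\<close> is a neighbourhood of \<open>x\<close> in the subspace, and fewer points
  compete in its supremum.\<close>

lemma osc_at_subtopology_le:
  assumes "bounded (\<phi> ` topspace X)" "x \<in> topspace X" "x \<in> S"
  shows "osc_at (subtopology X S) \<phi> x \<le> osc_at X \<phi> x"
  unfolding osc_at_def
proof (rule cINF_mono)
  show "{U. openin X U \<and> x \<in> U} \<noteq> {}"
    using assms(2) openin_topspace by blast
  have "bounded (\<phi> ` topspace (subtopology X S))"
    using assms(1) by (rule bounded_subset) auto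
  then show "bdd_below ((\<lambda>U. SUP z\<in>U. \<bar>\<phi> x - \<phi> z\<bar>) ` {U. openin (subtopology X S) U \<and> x \<in> U})"
    by (rule bdd_below_SUP_deviation)
next
  fix U assume "U \<in> {U. openin X U \<and> x \<in> U}"
  then have U: "openin X U" "x \<in> U" by auto
  have "(SUP z\<in>U \<inter> S. \<bar>\<phi> x - \<phi> z\<bar>) \<le> (SUP z\<in>U. \<bar>\<phi> x - \<phi> z\<bar>)"
    using U assms by (intro cSUP_subset_mono bdd_above_deviation) auto
  moreover have "U \<inter> S \<in> {U. openin (subtopology X S) U \<and> x \<in> U}"
    using U assms(3) by (auto intro: openin_subtopology_Int)
  ultimately show "\<exists>T\<in>{U. openin (subtopology X S) U \<and> x \<in> U}.
      (SUP z\<in>T. \<bar>\<phi> x - \<phi> z\<bar>) \<le> (SUP z\<in>U. \<bar>\<phi> x - \<phi> z\<bar>)"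
    by blast
qed

lemma osc_on_subtopology_le:
  assumes "bounded (\<phi> ` topspace X)" "A \<subseteq> topspace X" "B \<subseteq> A \<inter> S" "B \<noteq> {}"
  shows "osc_on (subtopology X S) \<phi> B \<le> osc_on X \<phi> A"
proof -
  have "(SUP x\<in>B. osc_at (subtopology X S) \<phi> x) \<le> (SUP x\<in>A. osc_at X \<phi> x)"
  proof (rule cSUP_mono)
    show "B \<noteq> {}" by (rule assms(4))
    show "bdd_above (osc_at X \<phi> ` A)"
      using assms(1,2) by (rule bdd_above_osc_at)
    show "\<exists>m\<in>A. osc_at (subtopology X S) \<phi> x \<le> osc_at X \<phi> m" if "x \<in> B" for x
      using that assms(1-3) by (intro bexI[of _ x] osc_at_subtopology_le) auto
  qed
  then show ?thesis
    using assms(3,4) by (auto simp: osc_on_def)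
qed

lemma top_preimage_subtopology_restrict:
  "top_preimage (subtopology X S) (restrict f S) B = top_preimage X f B \<inter> S"
  by (auto simp: top_preimage_def)

lemma top_preimage_subtopology:
  "top_preimage (subtopology X S) f B = top_preimage X f B \<inter> S"
  by (auto simp: top_preimage_def)

lemma equicontinuous_map_at_restrict:
  assumes "equicontinuous_map_at X Y f \<phi> y"
  shows "equicontinuous_map_at (subtopology X S) Y (restrict f S) \<phi> y"
  unfolding equicontinuous_map_at_def
proof (intro conjI allI impI)
  have range: "\<phi> n \<in> topspace X \<rightarrow> {0..1}" for n
    using assms by (simp add: equicontinuous_map_at_def)
  then show "\<phi> n \<in> topspace (subtopology X S) \<rightarrow> {0..1}" for n
    by fastforce
  have bounded: "bounded (\<phi> n ` topspace X)" for n
    using range[of n] by (intro bounded_subset[OF bounded_closed_interval[of 0 1]]) auto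
  fix \<epsilon> :: real
  assume "\<epsilon> > 0"
  then obtain V where V: "openin Y V" "y \<in> V"
      and osc: "\<And>n. osc_on X (\<phi> n) (top_preimage X f V) < \<epsilon>"
    using assms unfolding equicontinuous_map_at_def by blast
  have "osc_on (subtopology X S) (\<phi> n) (top_preimage X f V \<inter> S) < \<epsilon>" for n
  proof (cases "top_preimage X f V \<inter> S = {}")
    \<comment> \<open>The value of the oscillation on the empty set is a convention, not a supremum.\<close>
    case True
    then show ?thesis
      using \<open>\<epsilon> > 0\<close> by (simp add: osc_on_def)
  next
    case False
    then have "osc_on (subtopology X S) (\<phi> n) (top_preimage X f V \<inter> S)
        \<le> osc_on X (\<phi> n) (top_preimage X f V)"
      by (intro osc_on_subtopology_le bounded) (auto simp: top_preimage_def)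
    then show ?thesis
      using osc[of n] by (rule le_less_trans)
  qed
  then show "\<exists>V. openin Y V \<and> y \<in> V \<and> (\<forall>n. osc_on (subtopology X S) (\<phi> n)
      (top_preimage (subtopology X S) (restrict f S) V) < \<epsilon>)"
    using V by (auto simp: top_preimage_subtopology_restrict)
qed

theorem proposition5p1:
  fixes X :: "'a topology" and Y :: "'b topology" and f :: "'a \<Rightarrow> 'b" and X0 :: "'a set"
  assumes "perfectly_normal_map X Y f"
    and "X0 \<subseteq> topspace X"
  shows "perfectly_normal_map (subtopology X X0) Y (restrict f X0)"
  unfolding perfectly_normal_map_def
proof (intro conjI allI impI)
  have "continuous_map (subtopology X X0) Y f"
    using assms(1) unfolding perfectly_normal_map_def
    by (blast intro: continuous_map_from_subtopology)
  then show "continuous_map (subtopology X X0) Y (restrict f X0)"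
    by (rule continuous_map_eq) auto
next
  fix W0 y
  assume "openin (subtopology X X0) W0" and y: "y \<in> topspace Y"
  then obtain W where W: "openin X W" and W0: "W0 = W \<inter> X0"
    unfolding openin_subtopology by blast
  obtain V \<phi> where V: "openin Y V" "y \<in> V"
      and equi: "equicontinuous_map_at X Y f \<phi> y"
      and one: "W \<inter> top_preimage X f V =
        (\<Union>l. top_preimage X (\<phi> l) {1} \<inter> top_preimage X f V)"
      and zero: "\<And>l. top_preimage X f V - W \<subseteq>
        top_preimage X (\<phi> l) {0} \<inter> top_preimage X f V"
    using assms(1) W y unfolding perfectly_normal_map_def by meson
  let ?X0 = "subtopology X X0"
  let ?f0 = "restrict f X0"
  have "W0 \<inter> top_preimage ?X0 ?f0 V = (W \<inter> top_preimage X f V) \<inter> X0"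
    by (auto simp: W0 top_preimage_subtopology_restrict)
  also have "\<dots> = (\<Union>l. top_preimage ?X0 (\<phi> l) {1} \<inter> top_preimage ?X0 ?f0 V)"
    unfolding one top_preimage_subtopology_restrict by (auto simp: top_preimage_subtopology)
  finally have one0: "W0 \<inter> top_preimage ?X0 ?f0 V =
      (\<Union>l. top_preimage ?X0 (\<phi> l) {1} \<inter> top_preimage ?X0 ?f0 V)" .
  have zero0: "top_preimage ?X0 ?f0 V - W0 \<subseteq>
      top_preimage ?X0 (\<phi> l) {0} \<inter> top_preimage ?X0 ?f0 V" for l
    using zero[of l] unfolding top_preimage_subtopology_restrict
    by (auto simp: W0 top_preimage_subtopology)
  show "\<exists>V \<phi>. openin Y V \<and> y \<in> V \<and> equicontinuous_map_at ?X0 Y ?f0 \<phi> y \<and>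
      W0 \<inter> top_preimage ?X0 ?f0 V =
        (\<Union>l. top_preimage ?X0 (\<phi> l) {1} \<inter> top_preimage ?X0 ?f0 V) \<and>
      (\<forall>l. top_preimage ?X0 ?f0 V - W0 \<subseteq>
        top_preimage ?X0 (\<phi> l) {0} \<inter> top_preimage ?X0 ?f0 V)"
    using V equicontinuous_map_at_restrict[OF equi] one0 zero0
    by (intro exI[of _ V] exI[of _ \<phi>]) blast
qed

end
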